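(* Let $D$ be a finite generalized digroup, fix a bar-unit $\xi\in\mathrm{Halo}(D)$, and identify $D\simeq G\times E$ with $G=G_l^{\xi}$ and $E=\mathrm{Halo}(D)$ by the structure isomorphism recalled in the context. Then the conjugation rack $\mathrm{Conj}(D)$ is the rack on $G\times E$ given by $$(g,\alpha)\triangleright(h,\beta)=(ghg^{-1},g\bullet\beta).$$ Moreover: (1) the projection $\pi:\mathrm{Conj}(D)\to\mathrm{Conj}(G)$, $\pi(g,\alpha)=g$, is a surjective rack morphism; (2) for every $(g,\alpha)\in G\times E$, the left translation is $L_{(g,\alpha)}=c_g\times\rho(g)$, hence it depends only on the first coordinate $g$; (3) the inner permutation group of $\mathrm{Conj}(D)$ satisfies $$\mathrm{Inn}(\mathrm{Conj}(D))\cong G/\bigl(Z(G)\cap\mathrm{Ker}(\rho)\bigr).$$ In particular, $\mathrm{Conj}(D)$ is a rack over the ordinary conjugation rack $\mathrm{Conj}(G)$, with fiber $E$.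
   Context: A generalized digroup is a nonempty set $D$ with two associative binary operations $\vdash,\dashv$ satisfying $x\vdash(y\dashv z)=(x\vdash y)\dashv z$, $x\dashv(y\dashv z)=x\dashv(y\vdash z)$, $(x\vdash y)\vdash z=(x\dashv y)\vdash z$, such that there is at least one bar-unit (an element $\xi$ with $x\dashv\xi=x=\xi\vdash x$ for all $x\in D$), and for every bar-unit $\xi$ and every $x\in D$ there are $x^{-1}_{r,\xi},x^{-1}_{l,\xi}\in D$ with $x\vdash x^{-1}_{r,\xi}=\xi$ and $x^{-1}_{l,\xi}\dashv x=\xi$. $\mathrm{Halo}(D)$ is the set of bar-units. Structure isomorphism (known): fix a bar-unit $\xi$. Let $G:=G_l^\xi=\{\xi\dashv x\mid x\in D\}$, the left group associated with $\xi$; it is a group under $\dashv$ with identity $\xi$ (law written multiplicatively). Let $E:=\mathrm{Halo}(D)$, a left $G$-set via $g\bullet\alpha:=g\vdash\alpha\dashv g^{-1}$ ($g^{-1}$ the inverse in $G$). Then $G\times E$ with $(g,\alpha)\vdash(h,\beta)=(gh,g\bullet\beta)$ and $(g,\alpha)\dashv(h,\beta)=(gh,\alpha)$ is a generalized digroup, and $x\mapsto(\xi\dashv x,\ x\dashv x^{-1}_{l,\xi})$ is an isomorphism $D\to G\times E$, used to identify them. A rack is a nonempty set $X$ with a binary operation $\triangleright$ such that each left translation $L_x(y)=x\triangleright y$ is bijective and $x\triangleright(y\triangleright z)=(x\triangleright y)\triangleright(x\triangleright z)$; rack morphisms preserve $\triangleright$. $\mathrm{Inn}(X)$ is the subgroup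 of $\mathrm{Sym}(X)$ generated by all $L_x$. The conjugation rack $\mathrm{Conj}(D)$ is the set $D$ with $x\triangleright y:=(x\vdash y)\dashv x^{-1}$, where $x^{-1}$ is any one-sided inverse of $x$ (right for $\vdash$ or left for $\dashv$) relative to a bar-unit; this is independent of the choice. $\mathrm{Conj}(G)$ is the group $G$ with $g\triangleright h=ghg^{-1}$. Notation: $\rho:G\to\mathrm{Sym}(E)$, $\rho(g)(\beta)=g\bullet\beta$; $c_g:G\to G$, $c_g(h)=ghg^{-1}$; $(c_g\times\rho(g))(h,\beta)=(c_g(h),\rho(g)(\beta))$; $Z(G)$ is the center of $G$. *)

theory Defs
  imports "HOL-Algebra.Group_Action" "HOL-Algebra.Elementary_Groups"
begin

section \<open>Generalized digroups\<close>

record 'a digroup = "'a partial_object" +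
  vd :: "['a, 'a] \<Rightarrow> 'a"  (infixl \<open>\<turnstile>\<index>\<close> 70)
  dv :: "['a, 'a] \<Rightarrow> 'a"  (infixl \<open>\<stileturn>\<index>\<close> 70)

definition halo :: "('a, 'm) digroup_scheme \<Rightarrow> 'a set"
  where "halo D = {\<xi> \<in> carrier D. \<forall>x \<in> carrier D. x \<stileturn>\<^bsub>D\<^esub> \<xi> = x \<and> \<xi> \<turnstile>\<^bsub>D\<^esub> x = x}"

locale generalized_digroup =
  fixes D :: "('a, 'm) digroup_scheme" (structure)
  assumes vd_closed [simp]: "\<lbrakk>x \<in> carrier D; y \<in> carrier D\<rbrakk> \<Longrightarrow> x \<turnstile> y \<in> carrier D"
    and dv_closed [simp]: "\<lbrakk>x \<in> carrier D; y \<in> carrier D\<rbrakk> \<Longrightarrow> x \<stileturn> y \<in> carrier D"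
    and vd_assoc: "\<lbrakk>x \<in> carrier D; y \<in> carrier D; z \<in> carrier D\<rbrakk>
          \<Longrightarrow> (x \<turnstile> y) \<turnstile> z = x \<turnstile> (y \<turnstile> z)"
    and dv_assoc: "\<lbrakk>x \<in> carrier D; y \<in> carrier D; z \<in> carrier D\<rbrakk>
          \<Longrightarrow> (x \<stileturn> y) \<stileturn> z = x \<stileturn> (y \<stileturn> z)"
    and vd_dv_assoc: "\<lbrakk>x \<in> carrier D; y \<in> carrier D; z \<in> carrier D\<rbrakk>
          \<Longrightarrow> x \<turnstile> (y \<stileturn> z) = (x \<turnstile> y) \<stileturn> z"
    and dv_right: "\<lbrakk>x \<in> carrier D; y \<in> carrier D; z \<in> carrier D\<rbrakk>
          \<Longrightarrow> x \<stileturn> (y \<stileturn> z) = x \<stileturn> (y \<turnstile> z)"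
    and vd_left: "\<lbrakk>x \<in> carrier D; y \<in> carrier D; z \<in> carrier D\<rbrakk>
          \<Longrightarrow> (x \<turnstile> y) \<turnstile> z = (x \<stileturn> y) \<turnstile> z"
    and halo_nonempty: "halo D \<noteq> {}"
    and right_inverse_ex: "\<lbrakk>\<xi> \<in> halo D; x \<in> carrier D\<rbrakk> \<Longrightarrow> \<exists>y \<in> carrier D. x \<turnstile> y = \<xi>"
    and left_inverse_ex: "\<lbrakk>\<xi> \<in> halo D; x \<in> carrier D\<rbrakk> \<Longrightarrow> \<exists>y \<in> carrier D. y \<stileturn> x = \<xi>"

text \<open>Existence and uniqueness are lemmas \<open>left_inverse_ex\<close> and \<open>left_inverse_unique\<close>.\<close>

definition left_inv :: "('a, 'm) digroup_scheme \<Rightarrow> 'a \<Rightarrow> 'a \<Rightarrow> 'a"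
  where "left_inv D \<xi> x = (THE y. y \<in> carrier D \<and> y \<stileturn>\<^bsub>D\<^esub> x = \<xi>)"

definition digroup_iso ::
    "('a, 'm) digroup_scheme \<Rightarrow> ('b, 'n) digroup_scheme \<Rightarrow> ('a \<Rightarrow> 'b) set"
  where "digroup_iso D P = {f. bij_betw f (carrier D) (carrier P) \<and>
    (\<forall>x \<in> carrier D. \<forall>y \<in> carrier D.
       f (x \<turnstile>\<^bsub>D\<^esub> y) = f x \<turnstile>\<^bsub>P\<^esub> f y \<and> f (x \<stileturn>\<^bsub>D\<^esub> y) = f x \<stileturn>\<^bsub>P\<^esub> f y)}"

context generalized_digroup
begin

lemma haloD:
  assumes "\<xi> \<in> halo D"
  shows "\<xi> \<in> carrier D" "x \<in> carrier D \<Longrightarrow> x \<stileturn> \<xi> = x" "x \<in> carrier D \<Longrightarrow> \<xi> \<turnstile> x = x"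
  using assms by (auto simp: halo_def)

lemma left_inverse_unique:
  assumes x: "x \<in> carrier D" and xi: "\<xi> \<in> halo D"
    and y: "y \<in> carrier D" "y \<stileturn> x = \<xi>" and z: "z \<in> carrier D" "z \<stileturn> x = \<xi>"
  shows "y = z"
proof -
  obtain r where r: "r \<in> carrier D" "x \<turnstile> r = \<xi>"
    using right_inverse_ex[OF xi x] by blast
  have "w = \<xi> \<stileturn> r" if "w \<in> carrier D" "w \<stileturn> x = \<xi>" for w
  proof -
    have "w = w \<stileturn> (x \<turnstile> r)" using that r xi by (simp add: haloD)
    also have "\<dots> = (w \<stileturn> x) \<stileturn> r" using that r x by (metis dv_right dv_assoc)
    finally show ?thesis using that by simp
  qed
  then show ?thesis using y z by metis
qed

lemma left_inv:
  assumes x: "x \<in> carrier D" and xi: "\<xi> \<in> halo D"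
  shows "left_inv D \<xi> x \<in> carrier D" "left_inv D \<xi> x \<stileturn> x = \<xi>"
proof -
  have "\<exists>!y. y \<in> carrier D \<and> y \<stileturn> x = \<xi>"
    using left_inverse_ex[OF xi x] left_inverse_unique[OF x xi] by blast
  from theI'[OF this]
  show "left_inv D \<xi> x \<in> carrier D" "left_inv D \<xi> x \<stileturn> x = \<xi>"
    by (simp_all add: left_inv_def)
qed

lemma left_inv_eqI:
  assumes "x \<in> carrier D" "\<xi> \<in> halo D" "y \<in> carrier D" "y \<stileturn> x = \<xi>"
  shows "left_inv D \<xi> x = y"
  using left_inverse_unique[OF assms(1,2) left_inv[OF assms(1,2)] assms(3,4)] .

end

section \<open>The structure isomorphism\<close>

definition left_group :: "('a, 'm) digroup_scheme \<Rightarrow> 'a \<Rightarrow> 'a monoid"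
  where "left_group D \<xi> =
    \<lparr>carrier = (\<lambda>x. \<xi> \<stileturn>\<^bsub>D\<^esub> x) ` carrier D, monoid.mult = dv D, one = \<xi>\<rparr>"

definition halo_act :: "('a, 'm) digroup_scheme \<Rightarrow> 'a \<Rightarrow> 'a \<Rightarrow> 'a \<Rightarrow> 'a"
  where "halo_act D \<xi> g \<alpha> = (g \<turnstile>\<^bsub>D\<^esub> \<alpha>) \<stileturn>\<^bsub>D\<^esub> inv\<^bsub>left_group D \<xi>\<^esub> g"

text \<open>
  Permutations are kept extensional, as required by \<^const>\<open>BijGroup\<close>.  Lemmas
  \<open>group_left_group\<close>, \<open>group_action_halo\<close> and \<open>structure_map_iso\<close> below confirm that
  these data form a group, an action and the structure isomorphism.
\<close>

definition halo_perm :: "('a, 'm) digroup_scheme \<Rightarrow> 'a \<Rightarrow> 'a \<Rightarrow> 'a \<Rightarrow> 'a"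
  where "halo_perm D \<xi> g = restrict (halo_act D \<xi> g) (halo D)"

definition action_digroup ::
    "('a, 'm) monoid_scheme \<Rightarrow> 'b set \<Rightarrow> ('a \<Rightarrow> 'b \<Rightarrow> 'b) \<Rightarrow> ('a \<times> 'b) digroup"
  where "action_digroup G E act =
    \<lparr>carrier = carrier G \<times> E,
     vd = (\<lambda>(g, \<alpha>) (h, \<beta>). (g \<otimes>\<^bsub>G\<^esub> h, act g \<beta>)),
     dv = (\<lambda>(g, \<alpha>) (h, \<beta>). (g \<otimes>\<^bsub>G\<^esub> h, \<alpha>))\<rparr>"

definition structure_map :: "('a, 'm) digroup_scheme \<Rightarrow> 'a \<Rightarrow> 'a \<Rightarrow> 'a \<times> 'a"
  where "structure_map D \<xi> x = (\<xi> \<stileturn>\<^bsub>D\<^esub> x, x \<stileturn>\<^bsub>D\<^esub> left_inv D \<xi> x)"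

section \<open>Racks\<close>

record 'a rack = "'a partial_object" +
  rack_op :: "['a, 'a] \<Rightarrow> 'a"  (infixl \<open>\<triangleright>\<index>\<close> 70)

text \<open>Closure of the carrier is part of \<open>translation_bij\<close>.\<close>

locale rack =
  fixes X :: "('a, 'm) rack_scheme" (structure)
  assumes nonempty: "carrier X \<noteq> {}"
    and translation_bij: "x \<in> carrier X \<Longrightarrow> bij_betw (\<lambda>y. x \<triangleright> y) (carrier X) (carrier X)"
    and self_distrib: "\<lbrakk>x \<in> carrier X; y \<in> carrier X; z \<in> carrier X\<rbrakk>
          \<Longrightarrow> x \<triangleright> (y \<triangleright> z) = (x \<triangleright> y) \<triangleright> (x \<triangleright> z)"

definition rack_hom :: "('a, 'm) rack_scheme \<Rightarrow> ('b, 'n) rack_scheme \<Rightarrow> ('a \<Rightarrow> 'b) set"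
  where "rack_hom X Y = {f \<in> carrier X \<rightarrow> carrier Y.
    \<forall>x \<in> carrier X. \<forall>y \<in> carrier X. f (x \<triangleright>\<^bsub>X\<^esub> y) = f x \<triangleright>\<^bsub>Y\<^esub> f y}"

definition rack_iso :: "('a, 'm) rack_scheme \<Rightarrow> ('b, 'n) rack_scheme \<Rightarrow> ('a \<Rightarrow> 'b) set"
  where "rack_iso X Y = {f \<in> rack_hom X Y. bij_betw f (carrier X) (carrier Y)}"

definition left_translation :: "('a, 'm) rack_scheme \<Rightarrow> 'a \<Rightarrow> 'a \<Rightarrow> 'a"
  where "left_translation X x = (\<lambda>y \<in> carrier X. x \<triangleright>\<^bsub>X\<^esub> y)"

text \<open>
  \<^const>\<open>subgroup_generated\<close> intersects the generators with the carrier of the group; for a rack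
  all left translations already lie in it.
\<close>

definition Inn :: "('a, 'm) rack_scheme \<Rightarrow> ('a \<Rightarrow> 'a) monoid"
  where "Inn X =
    subgroup_generated (BijGroup (carrier X)) (left_translation X ` carrier X)"

definition rack_over ::
    "('a, 'm) rack_scheme \<Rightarrow> ('b, 'n) rack_scheme \<Rightarrow> ('a \<Rightarrow> 'b) \<Rightarrow> bool"
  where "rack_over X Y p \<longleftrightarrow>
    rack X \<and> rack Y \<and> p \<in> rack_hom X Y \<and> p ` carrier X = carrier Y"

section \<open>Conjugation racks\<close>

definition one_sided_inverse :: "('a, 'm) digroup_scheme \<Rightarrow> 'a \<Rightarrow> 'a \<Rightarrow> bool"
  where "one_sided_inverse D x z \<longleftrightarrow>
    z \<in> carrier D \<and> (x \<turnstile>\<^bsub>D\<^esub> z \<in> halo D \<or> z \<stileturn>\<^bsub>D\<^esub> x \<in> halo D)"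

text \<open>
  The inverse in the conjugation operation may be any one-sided inverse, relative to any bar-unit;
  lemma \<open>conj_rack_op_eq\<close> below shows that the choice does not matter.
\<close>

definition conj_rack :: "('a, 'm) digroup_scheme \<Rightarrow> 'a rack"
  where "conj_rack D =
    \<lparr>carrier = carrier D,
     rack_op = (\<lambda>x y. (x \<turnstile>\<^bsub>D\<^esub> y) \<stileturn>\<^bsub>D\<^esub> (SOME z. one_sided_inverse D x z))\<rparr>"

definition conj_group_rack :: "('a, 'm) monoid_scheme \<Rightarrow> 'a rack"
  where "conj_group_rack G =
    \<lparr>carrier = carrier G, rack_op = (\<lambda>g h. g \<otimes>\<^bsub>G\<^esub> h \<otimes>\<^bsub>G\<^esub> inv\<^bsub>G\<^esub> g)\<rparr>"

definition center :: "('a, 'm) monoid_scheme \<Rightarrow> 'a set"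
  where "center G = {z \<in> carrier G. \<forall>g \<in> carrier G. z \<otimes>\<^bsub>G\<^esub> g = g \<otimes>\<^bsub>G\<^esub> z}"

section \<open>The known facts on which the definitions rest\<close>

context generalized_digroup
begin

lemma dv_right_left_inverse:
  assumes x: "x \<in> carrier D" and y: "y \<in> carrier D"
    and z: "z \<in> carrier D" "x \<turnstile> z \<in> halo D" and w: "w \<in> carrier D" "w \<stileturn> x \<in> halo D"
  shows "y \<stileturn> z = y \<stileturn> w"
proof -
  have "y \<stileturn> z = (y \<stileturn> (w \<stileturn> x)) \<stileturn> z" using w y by (simp add: haloD)
  also have "\<dots> = (y \<stileturn> w) \<stileturn> (x \<stileturn> z)" using x y z w by (simp add: dv_assoc)
  also have "\<dots> = (y \<stileturn> w) \<stileturn> (x \<turnstile> z)" using x y z w by (simp add: dv_right)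
  also have "\<dots> = y \<stileturn> w" using z w y by (simp add: haloD)
  finally show ?thesis .
qed

lemma dv_one_sided_inverse:
  assumes x: "x \<in> carrier D" and y: "y \<in> carrier D"
    and "one_sided_inverse D x z" "one_sided_inverse D x w"
  shows "y \<stileturn> z = y \<stileturn> w"
proof -
  obtain \<xi> where xi: "\<xi> \<in> halo D" using halo_nonempty by blast
  obtain r where r: "r \<in> carrier D" "x \<turnstile> r \<in> halo D"
    using right_inverse_ex[OF xi x] xi by metis
  obtain l where l: "l \<in> carrier D" "l \<stileturn> x \<in> halo D"
    using left_inverse_ex[OF xi x] xi by metis
  have "y \<stileturn> u = y \<stileturn> l" if "one_sided_inverse D x u" for u
    using that dv_right_left_inverse[OF x y] r l unfolding one_sided_inverse_def by metis
  then show ?thesis using assms by metis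
qed

lemma one_sided_inverse_left_inv:
  assumes "x \<in> carrier D" "\<xi> \<in> halo D"
  shows "one_sided_inverse D x (left_inv D \<xi> x)"
  using assms by (simp add: one_sided_inverse_def left_inv)

lemma conj_rack_op_eq:
  assumes "x \<in> carrier D" "y \<in> carrier D" "one_sided_inverse D x z"
  shows "x \<triangleright>\<^bsub>conj_rack D\<^esub> y = (x \<turnstile> y) \<stileturn> z"
proof -
  have "one_sided_inverse D x (SOME w. one_sided_inverse D x w)"
    using assms(3) by (rule someI)
  from dv_one_sided_inverse[OF assms(1) vd_closed[OF assms(1,2)] this assms(3)]
  show ?thesis by (simp add: conj_rack_def)
qed

end

locale pointed_generalized_digroup = generalized_digroup +
  fixes \<xi> and G and E
  assumes xi: "\<xi> \<in> halo D"
  defines G_def: "G \<equiv> left_group D \<xi>" and E_def: "E \<equiv> halo D"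
begin

lemma xi_D [simp]: "\<xi> \<in> carrier D" using xi by (simp add: haloD)
lemma G_sel [simp]: "monoid.mult G = dv D" "monoid.one G = \<xi>"
  by (simp_all add: G_def left_group_def)
lemma G_carrier: "carrier G = (\<lambda>x. \<xi> \<stileturn> x) ` carrier D"
  by (simp add: G_def left_group_def)
lemma G_sub: "g \<in> carrier G \<Longrightarrow> g \<in> carrier D"
  by (auto simp: G_carrier)
lemma G_closed_xi: "x \<in> carrier D \<Longrightarrow> \<xi> \<stileturn> x \<in> carrier G"
  by (auto simp: G_carrier)
lemma dv_xi_absorb: "\<lbrakk>x \<in> carrier D; y \<in> carrier D\<rbrakk> \<Longrightarrow> y \<stileturn> (\<xi> \<stileturn> x) = y \<stileturn> x"
  using xi by (simp add: dv_right haloD)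
lemma xi_G: "g \<in> carrier G \<Longrightarrow> \<xi> \<stileturn> g = g"
  by (auto simp: G_carrier dv_xi_absorb)

declare G_sub [simp] G_closed_xi [simp]

lemma left_inv_D [simp]: "x \<in> carrier D \<Longrightarrow> left_inv D \<xi> x \<in> carrier D"
  and left_inv_eq: "x \<in> carrier D \<Longrightarrow> left_inv D \<xi> x \<stileturn> x = \<xi>"
  by (simp_all add: left_inv xi)

lemma group_left_group: "group G"
proof (rule groupI)
  show "x \<otimes>\<^bsub>G\<^esub> y \<in> carrier G" if "x \<in> carrier G" "y \<in> carrier G" for x y
  proof -
    have "x \<stileturn> y = \<xi> \<stileturn> (x \<stileturn> y)" using that xi_G by (metis G_sub dv_assoc xi_D)
    then show ?thesis using that by (metis G_closed_xi G_sel(1) G_sub dv_closed)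
  qed
  show "\<one>\<^bsub>G\<^esub> \<in> carrier G" by (metis G_closed_xi G_sel(2) haloD(2) xi xi_D)
  show "x \<otimes>\<^bsub>G\<^esub> y \<otimes>\<^bsub>G\<^esub> z = x \<otimes>\<^bsub>G\<^esub> (y \<otimes>\<^bsub>G\<^esub> z)"
    if "x \<in> carrier G" "y \<in> carrier G" "z \<in> carrier G" for x y z
    using that by (simp add: dv_assoc)
  show "\<one>\<^bsub>G\<^esub> \<otimes>\<^bsub>G\<^esub> x = x" if "x \<in> carrier G" for x
    using that by (simp add: xi_G)
  show "\<exists>y\<in>carrier G. y \<otimes>\<^bsub>G\<^esub> x = \<one>\<^bsub>G\<^esub>" if "x \<in> carrier G" for x
  proof
    show "\<xi> \<stileturn> left_inv D \<xi> x \<in> carrier G" using that by simp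
    have "(\<xi> \<stileturn> left_inv D \<xi> x) \<stileturn> x = \<xi> \<stileturn> \<xi>" using that by (simp add: dv_assoc left_inv_eq)
    then show "(\<xi> \<stileturn> left_inv D \<xi> x) \<otimes>\<^bsub>G\<^esub> x = \<one>\<^bsub>G\<^esub>" using xi by (simp add: haloD)
  qed
qed

interpretation G: group G by (rule group_left_group)

lemma inv_D [simp]: "g \<in> carrier G \<Longrightarrow> inv\<^bsub>G\<^esub> g \<in> carrier D"
  by (metis G.inv_closed G_sub)

lemma inv_G: "g \<in> carrier G \<Longrightarrow> g \<stileturn> inv\<^bsub>G\<^esub> g = \<xi>" "g \<in> carrier G \<Longrightarrow> inv\<^bsub>G\<^esub> g \<stileturn> g = \<xi>"
  using G.r_inv[of g] G.l_inv[of g] by auto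

lemma act_eq: "halo_act D \<xi> g \<alpha> = (g \<turnstile> \<alpha>) \<stileturn> inv\<^bsub>G\<^esub> g"
  by (simp add: halo_act_def G_def)

lemma E_D [simp]: "\<alpha> \<in> E \<Longrightarrow> \<alpha> \<in> carrier D" by (simp add: E_def haloD)
lemma E_unit [simp]:
  "\<lbrakk>\<alpha> \<in> E; x \<in> carrier D\<rbrakk> \<Longrightarrow> x \<stileturn> \<alpha> = x" "\<lbrakk>\<alpha> \<in> E; x \<in> carrier D\<rbrakk> \<Longrightarrow> \<alpha> \<turnstile> x = x"
  by (simp_all add: E_def haloD)
lemma xi_E [simp]: "\<xi> \<in> E" using xi by (simp add: E_def)
lemma E_I: "\<lbrakk>a \<in> carrier D; \<And>x. x \<in> carrier D \<Longrightarrow> x \<stileturn> a = x; \<And>x. x \<in> carrier D \<Longrightarrow> a \<turnstile> x = x\<rbrakk> \<Longrightarrow> a \<in> E"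
  unfolding E_def halo_def by blast

lemma act_closed:
  assumes g: "g \<in> carrier G" and a: "\<alpha> \<in> E"
  shows "halo_act D \<xi> g \<alpha> \<in> E"
proof (rule E_I)
  let ?i = "inv\<^bsub>G\<^esub> g"
  show "halo_act D \<xi> g \<alpha> \<in> carrier D" using g a by (simp add: act_eq)
  fix x assume x: "x \<in> carrier D"
  have "x \<stileturn> ((g \<turnstile> \<alpha>) \<stileturn> ?i) = (x \<stileturn> (g \<stileturn> \<alpha>)) \<stileturn> ?i"
    using g a x by (metis dv_assoc dv_right E_D G_sub inv_D vd_closed)
  also have "\<dots> = x \<stileturn> (g \<stileturn> ?i)" using g a x by (simp add: dv_assoc)
  also have "\<dots> = x" using g x by (simp add: inv_G)
  finally show "x \<stileturn> halo_act D \<xi> g \<alpha> = x" by (simp add: act_eq)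
  have "((g \<turnstile> \<alpha>) \<stileturn> ?i) \<turnstile> x = ((g \<turnstile> \<alpha>) \<turnstile> ?i) \<turnstile> x"
    using g a x by (simp add: vd_left[symmetric])
  also have "\<dots> = (g \<turnstile> ?i) \<turnstile> x" using g a by (simp add: vd_assoc)
  also have "\<dots> = (g \<stileturn> ?i) \<turnstile> x" using g x by (simp add: vd_left)
  also have "\<dots> = x" using g x by (simp add: inv_G)
  finally show "halo_act D \<xi> g \<alpha> \<turnstile> x = x" by (simp add: act_eq)
qed

lemma act_one:
  assumes "\<alpha> \<in> E" shows "halo_act D \<xi> \<xi> \<alpha> = \<alpha>"
  using assms G.inv_one by (simp add: act_eq)

lemma act_mult:
  assumes g: "g \<in> carrier G" and h: "h \<in> carrier G" and a: "\<alpha> \<in> E"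
  shows "halo_act D \<xi> (g \<stileturn> h) \<alpha> = halo_act D \<xi> g (halo_act D \<xi> h \<alpha>)"
proof -
  have i: "inv\<^bsub>G\<^esub> (g \<stileturn> h) = inv\<^bsub>G\<^esub> h \<stileturn> inv\<^bsub>G\<^esub> g" using g h G.inv_mult_group by simp
  show ?thesis using g h a unfolding act_eq i
    by (simp add: vd_dv_assoc dv_assoc vd_left[symmetric] vd_assoc)
qed

lemma group_action_halo: "group_action G E (halo_perm D \<xi>)"
  unfolding group_action_def group_hom_def group_hom_axioms_def hom_def
proof (intro conjI CollectI ballI funcsetI)
  show "group G" by (rule group_left_group)
  show "group (BijGroup E)" by (rule group_BijGroup)
  have bij: "bij_betw (halo_act D \<xi> g) E E" if g: "g \<in> carrier G" for g
    by (rule bij_betw_byWitness[of _ "halo_act D \<xi> (inv\<^bsub>G\<^esub> g)"])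
      (use g act_closed act_mult[symmetric] act_one inv_G G.inv_closed in auto)
  show mem: "halo_perm D \<xi> g \<in> carrier (BijGroup E)" if g: "g \<in> carrier G" for g
  proof -
    have "bij_betw (halo_perm D \<xi> g) E E"
      using bij[OF g] unfolding halo_perm_def E_def by simp
    then show ?thesis by (simp add: BijGroup_def Bij_def halo_perm_def E_def del: bij_betw_restrict_eq)
  qed
  fix g h assume gh: "g \<in> carrier G" "h \<in> carrier G"
  then have m: "g \<stileturn> h \<in> carrier G" using G.m_closed by simp
  have "halo_perm D \<xi> (g \<stileturn> h) = compose E (halo_perm D \<xi> g) (halo_perm D \<xi> h)"
    unfolding halo_perm_def compose_def E_def[symmetric]
    using gh by (intro restrict_ext) (simp add: act_mult act_closed)
  then show "halo_perm D \<xi> (g \<otimes>\<^bsub>G\<^esub> h) = halo_perm D \<xi> g \<otimes>\<^bsub>BijGroup E\<^esub> halo_perm D \<xi> h"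
    using mem[OF gh(1)] mem[OF gh(2)] by (simp add: BijGroup_def)
qed

lemma halo_coordinate:
  assumes x: "x \<in> carrier D"
  shows "x \<stileturn> left_inv D \<xi> x \<in> E"
proof (rule E_I)
  let ?l = "left_inv D \<xi> x"
  obtain r where r: "r \<in> carrier D" "x \<turnstile> r = \<xi>" using right_inverse_ex[OF xi x] by blast
  show "x \<stileturn> ?l \<in> carrier D" using x by simp
  fix y assume y: "y \<in> carrier D"
  have "y \<stileturn> (x \<stileturn> ?l) = (y \<stileturn> x) \<stileturn> r"
    using dv_right_left_inverse[of x "y \<stileturn> x" r ?l] x y r xi by (simp add: left_inv_eq dv_assoc)
  also have "\<dots> = y \<stileturn> (x \<turnstile> r)" using x y r by (simp add: dv_assoc dv_right)
  finally show "y \<stileturn> (x \<stileturn> ?l) = y" using y by (simp add: r)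
  have l: "?l \<turnstile> (x \<turnstile> u) = u" if "u \<in> carrier D" for u
    using that x vd_left[of ?l x u] by (simp add: vd_assoc left_inv_eq)
  have "r \<turnstile> y = ?l \<turnstile> (x \<turnstile> (r \<turnstile> y))" using l r y by simp
  also have "\<dots> = ?l \<turnstile> ((x \<turnstile> r) \<turnstile> y)" using x y r(1) by (simp add: vd_assoc)
  also have "\<dots> = ?l \<turnstile> y" using y by (simp add: r)
  finally have ry: "r \<turnstile> y = ?l \<turnstile> y" .
  have "(x \<stileturn> ?l) \<turnstile> y = x \<turnstile> (?l \<turnstile> y)" using x y by (simp add: vd_left[symmetric] vd_assoc)
  also have "\<dots> = (x \<turnstile> r) \<turnstile> y" using x y r(1) ry by (simp add: vd_assoc)
  finally show "(x \<stileturn> ?l) \<turnstile> y = y" using y by (simp add: r)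
qed

lemma left_inv_mult:
  assumes "x \<in> carrier D" "y \<in> carrier D"
  shows "left_inv D \<xi> (x \<stileturn> y) = left_inv D \<xi> y \<stileturn> left_inv D \<xi> x"
    and "left_inv D \<xi> (x \<turnstile> y) = left_inv D \<xi> y \<stileturn> left_inv D \<xi> x"
proof -
  have *: "(left_inv D \<xi> y \<stileturn> left_inv D \<xi> x) \<stileturn> (x \<stileturn> y) = \<xi>"
  proof -
    have "(left_inv D \<xi> y \<stileturn> left_inv D \<xi> x) \<stileturn> (x \<stileturn> y)
        = left_inv D \<xi> y \<stileturn> (left_inv D \<xi> x \<stileturn> x) \<stileturn> y"
      using assms by (simp add: dv_assoc)
    then show ?thesis using assms by (simp add: left_inv_eq)
  qed
  then show "left_inv D \<xi> (x \<stileturn> y) = left_inv D \<xi> y \<stileturn> left_inv D \<xi> x"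
    by (intro left_inv_eqI) (use assms xi in auto)
  show "left_inv D \<xi> (x \<turnstile> y) = left_inv D \<xi> y \<stileturn> left_inv D \<xi> x"
    by (intro left_inv_eqI) (use assms xi * in \<open>auto simp: dv_right[symmetric]\<close>)
qed

lemma inv_xi:
  assumes x: "x \<in> carrier D"
  shows "inv\<^bsub>G\<^esub> (\<xi> \<stileturn> x) = \<xi> \<stileturn> left_inv D \<xi> x"
proof (rule G.inv_equality)
  show "\<xi> \<stileturn> left_inv D \<xi> x \<otimes>\<^bsub>G\<^esub> (\<xi> \<stileturn> x) = \<one>\<^bsub>G\<^esub>"
    using x by (simp add: dv_xi_absorb dv_assoc left_inv_eq)
qed (use x in auto)

theorem structure_map_iso:
  "structure_map D \<xi> \<in> digroup_iso D (action_digroup G E (halo_act D \<xi>))"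
  unfolding digroup_iso_def
proof (intro CollectI conjI ballI)
  let ?f = "structure_map D \<xi>"
  show "bij_betw ?f (carrier D) (carrier (action_digroup G E (halo_act D \<xi>)))"
  proof (rule bij_betw_byWitness[of _ "\<lambda>(g, \<alpha>). \<alpha> \<stileturn> g"])
    show "\<forall>x\<in>carrier D. (case ?f x of (g, \<alpha>) \<Rightarrow> \<alpha> \<stileturn> g) = x"
      by (simp add: structure_map_def dv_xi_absorb dv_assoc left_inv_eq)
    have "?f (\<alpha> \<stileturn> g) = (g, \<alpha>)" if g: "g \<in> carrier G" and a: "\<alpha> \<in> E" for g \<alpha>
    proof -
      have "inv\<^bsub>G\<^esub> g \<stileturn> (\<alpha> \<stileturn> g) = \<xi>"
        using g a by (simp add: dv_assoc[symmetric] inv_G)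
      then have l: "left_inv D \<xi> (\<alpha> \<stileturn> g) = inv\<^bsub>G\<^esub> g"
        by (intro left_inv_eqI) (use g a xi in auto)
      have "\<xi> \<stileturn> (\<alpha> \<stileturn> g) = g" using g a by (simp add: dv_assoc[symmetric] xi_G)
      then show ?thesis using g a by (simp add: structure_map_def l dv_assoc inv_G)
    qed
    then show "\<forall>p\<in>carrier (action_digroup G E (halo_act D \<xi>)). ?f (case p of (g, \<alpha>) \<Rightarrow> \<alpha> \<stileturn> g) = p"
      by (auto simp: action_digroup_def)
    show "?f ` carrier D \<subseteq> carrier (action_digroup G E (halo_act D \<xi>))"
      by (auto simp: action_digroup_def structure_map_def halo_coordinate)
    show "(\<lambda>(g, \<alpha>). \<alpha> \<stileturn> g) ` carrier (action_digroup G E (halo_act D \<xi>)) \<subseteq> carrier D"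
      by (auto simp: action_digroup_def)
  qed
  fix x y assume x: "x \<in> carrier D" and y: "y \<in> carrier D"
  let ?lx = "left_inv D \<xi> x" and ?ly = "left_inv D \<xi> y"
  have 1: "\<xi> \<stileturn> (x \<stileturn> y) = (\<xi> \<stileturn> x) \<stileturn> (\<xi> \<stileturn> y)"
    using x y by (simp add: dv_xi_absorb dv_assoc)
  have "(x \<stileturn> y) \<stileturn> (?ly \<stileturn> ?lx) = x \<stileturn> (y \<stileturn> ?ly) \<stileturn> ?lx"
    using x y by (simp add: dv_assoc)
  then have 2: "(x \<stileturn> y) \<stileturn> (?ly \<stileturn> ?lx) = x \<stileturn> ?lx"
    using x y halo_coordinate[OF y] by simp
  show "?f (x \<stileturn> y) = ?f x \<stileturn>\<^bsub>action_digroup G E (halo_act D \<xi>)\<^esub> ?f y"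
    using x y by (simp add: structure_map_def action_digroup_def left_inv_mult 1 2)
  have 3: "(x \<turnstile> y) \<stileturn> (?ly \<stileturn> ?lx) = (x \<turnstile> (y \<stileturn> ?ly)) \<stileturn> ?lx"
    using x y by (simp add: dv_assoc vd_dv_assoc)
  have 4: "(\<xi> \<stileturn> x) \<turnstile> (y \<stileturn> ?ly) = x \<turnstile> (y \<stileturn> ?ly)"
    using x y by (simp add: vd_left[symmetric])
  have "halo_act D \<xi> (\<xi> \<stileturn> x) (y \<stileturn> ?ly) = (x \<turnstile> (y \<stileturn> ?ly)) \<stileturn> ?lx"
    unfolding act_eq inv_xi[OF x] 4 using x y by (simp add: dv_xi_absorb)
  then show "?f (x \<turnstile> y) = ?f x \<turnstile>\<^bsub>action_digroup G E (halo_act D \<xi>)\<^esub> ?f y"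
    using x y
    by (simp add: structure_map_def action_digroup_def left_inv_mult 3 dv_right[symmetric] 1)
qed

end

end

theory Submission
  imports Defs
begin

text \<open>
  The translations by \<open>x\<close> and by \<open>\<xi> \<stileturn> x\<close> agree, because
  \<open>(\<xi> \<stileturn> x) \<turnstile> y = x \<turnstile> y\<close> and both elements have the same left inverse.  Hence
  the translations by elements of \<open>G\<close> already exhaust all of them, and since they depend
  homomorphically on \<open>G\<close>, they form the whole inner group.  The first isomorphism theorem thus
  reduces (3) to computing a kernel, which can be done inside \<open>D\<close>, without coordinates.
\<close>

section \<open>Conjugation racks\<close>

context pointed_generalized_digroup
begin

interpretation G: group G by (rule group_left_group)

text \<open>To the left of \<open>\<turnstile>\<close> the two operations are interchangeable
  (\<open>vd_left\<close>), so the bar-units \<open>left_inv D \<xi> x \<stileturn> x\<close> and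
  \<open>x \<stileturn> left_inv D \<xi> x\<close> act there as identities.\<close>

lemma vd_cancel:
  assumes x: "x \<in> carrier D" and y: "y \<in> carrier D"
  shows "left_inv D \<xi> x \<turnstile> (x \<turnstile> y) = y" "x \<turnstile> (left_inv D \<xi> x \<turnstile> y) = y"
proof -
  show "left_inv D \<xi> x \<turnstile> (x \<turnstile> y) = y"
    using x y vd_left[of "left_inv D \<xi> x" x y] by (simp add: vd_assoc left_inv_eq)
  show "x \<turnstile> (left_inv D \<xi> x \<turnstile> y) = y"
    using x y vd_left[of x "left_inv D \<xi> x" y] halo_coordinate[OF x] by (simp add: vd_assoc)
qed

lemma dv_cancel:
  assumes x: "x \<in> carrier D" and y: "y \<in> carrier D"
  shows "y \<stileturn> (left_inv D \<xi> x \<stileturn> x) = y" "y \<stileturn> (x \<stileturn> left_inv D \<xi> x) = y"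
  using x y halo_coordinate[OF x] by (simp_all add: left_inv_eq)

lemma conj_carrier [simp]: "carrier (conj_rack D) = carrier D"
  by (simp add: conj_rack_def)

lemma conj_op:
  assumes "x \<in> carrier D" "y \<in> carrier D"
  shows "x \<triangleright>\<^bsub>conj_rack D\<^esub> y = (x \<turnstile> y) \<stileturn> left_inv D \<xi> x"
  using assms by (intro conj_rack_op_eq one_sided_inverse_left_inv xi)

text \<open>The inverse has the shape x y^-1 x^-1. Its product with the conjugate is the bar-unit
  \<open>x \<stileturn> left_inv D \<xi> x\<close>, in general different from \<open>\<xi>\<close>;
  this is where an arbitrary bar-unit in \<open>one_sided_inverse\<close> pays off.\<close>

lemma one_sided_inverse_conj:
  assumes x: "x \<in> carrier D" and y: "y \<in> carrier D"
  shows "one_sided_inverse D (x \<triangleright>\<^bsub>conj_rack D\<^esub> y)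
           (x \<stileturn> (left_inv D \<xi> y \<stileturn> left_inv D \<xi> x))"
proof -
  let ?l = "left_inv D \<xi> x" and ?m = "left_inv D \<xi> y"
  have "(x \<stileturn> (?m \<stileturn> ?l)) \<stileturn> ((x \<turnstile> y) \<stileturn> ?l) = (x \<stileturn> (?m \<stileturn> ?l)) \<stileturn> ((x \<stileturn> y) \<stileturn> ?l)"
    using x y by (simp add: dv_assoc[symmetric]) (simp add: dv_right[symmetric] dv_assoc)
  also have "\<dots> = x \<stileturn> ((?m \<stileturn> (?l \<stileturn> x)) \<stileturn> (y \<stileturn> ?l))"
    using x y by (simp add: dv_assoc)
  also have "\<dots> = x \<stileturn> (?m \<stileturn> (y \<stileturn> ?l))"
    using x y by (simp add: dv_cancel)
  also have "\<dots> = x \<stileturn> ((?m \<stileturn> y) \<stileturn> ?l)"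
    using x y by (simp add: dv_assoc)
  also have "\<dots> = x \<stileturn> ?l"
    using x y by (simp add: left_inv_eq dv_xi_absorb)
  finally have "(x \<stileturn> (?m \<stileturn> ?l)) \<stileturn> ((x \<turnstile> y) \<stileturn> ?l) \<in> halo D"
    using halo_coordinate[OF x] by (simp add: E_def)
  then show ?thesis
    using x y by (simp add: one_sided_inverse_def conj_op)
qed

theorem rack_conj_rack: "rack (conj_rack D)"
proof
  show "carrier (conj_rack D) \<noteq> {}" using xi_D by (metis conj_carrier empty_iff)
next
  fix x assume "x \<in> carrier (conj_rack D)"
  then have x: "x \<in> carrier D" by simp
  let ?l = "left_inv D \<xi> x"
  have "bij_betw (\<lambda>y. x \<triangleright>\<^bsub>conj_rack D\<^esub> y) (carrier D) (carrier D)"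
  \<comment> \<open>The witness is the translation by \<open>?l\<close>: \<open>x\<close> is a
    one-sided inverse of \<open>?l\<close>, because \<open>x \<stileturn> ?l\<close> is a
    bar-unit.\<close>
  proof (rule bij_betw_byWitness[of _ "\<lambda>y. (?l \<turnstile> y) \<stileturn> x"])
    show "\<forall>y\<in>carrier D. (?l \<turnstile> (x \<triangleright>\<^bsub>conj_rack D\<^esub> y)) \<stileturn> x = y"
      using x by (simp add: conj_op vd_dv_assoc vd_cancel) (simp add: dv_assoc dv_cancel)
    show "\<forall>y\<in>carrier D. x \<triangleright>\<^bsub>conj_rack D\<^esub> ((?l \<turnstile> y) \<stileturn> x) = y"
      using x by (simp add: conj_op vd_dv_assoc vd_cancel) (simp add: dv_assoc dv_cancel)
  qed (use x in \<open>auto simp: conj_op\<close>)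
  then show "bij_betw (\<lambda>y. x \<triangleright>\<^bsub>conj_rack D\<^esub> y) (carrier (conj_rack D)) (carrier (conj_rack D))"
    by simp
next
  fix x y z
  assume "x \<in> carrier (conj_rack D)" "y \<in> carrier (conj_rack D)" "z \<in> carrier (conj_rack D)"
  then have x: "x \<in> carrier D" and y: "y \<in> carrier D" and z: "z \<in> carrier D" by auto
  let ?l = "left_inv D \<xi> x" and ?m = "left_inv D \<xi> y"
  let ?c = "\<lambda>x y. x \<triangleright>\<^bsub>conj_rack D\<^esub> y"
  \<comment> \<open>On the left of \<open>\<turnstile>\<close> the \<open>\<stileturn>\<close> in
    front of \<open>?l\<close> may become \<open>\<turnstile>\<close>, so \<open>?l\<close> meets
    the next \<open>x\<close> and cancels.\<close>
  have "?c x y \<turnstile> ?c x z = ((x \<turnstile> y) \<turnstile> ?l) \<turnstile> ((x \<turnstile> z) \<stileturn> ?l)"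
    using x y z by (simp add: conj_op vd_left[symmetric])
  also have "\<dots> = (x \<turnstile> (y \<turnstile> z)) \<stileturn> ?l"
    using x y z by (simp add: vd_dv_assoc vd_assoc) (simp add: vd_cancel flip: vd_dv_assoc)
  finally have 1: "?c x y \<turnstile> ?c x z = (x \<turnstile> (y \<turnstile> z)) \<stileturn> ?l" .
  \<comment> \<open>Choosing this inverse of \<open>?c x y\<close>, instead of its
    \<open>left_inv\<close>, lets the trailing \<open>?l\<close> cancel against the leading
    \<open>x\<close>.\<close>
  have "?c (?c x y) (?c x z) = (?c x y \<turnstile> ?c x z) \<stileturn> (x \<stileturn> (?m \<stileturn> ?l))"
    using x y z by (intro conj_rack_op_eq one_sided_inverse_conj) (simp_all add: conj_op)
  also have "\<dots> = ((x \<turnstile> (y \<turnstile> z)) \<stileturn> (?l \<stileturn> x)) \<stileturn> (?m \<stileturn> ?l)"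
    unfolding 1 using x y z by (simp add: dv_assoc)
  also have "\<dots> = (x \<turnstile> (y \<turnstile> z)) \<stileturn> (?m \<stileturn> ?l)"
    using x y z by (simp add: dv_cancel)
  also have "\<dots> = ?c x (?c y z)"
    using x y z by (simp add: conj_op vd_dv_assoc dv_assoc)
  finally show "?c x (?c y z) = ?c (?c x y) (?c x z)" by simp
qed

section \<open>The inner group\<close>

lemma left_inv_G: "g \<in> carrier G \<Longrightarrow> left_inv D \<xi> g = inv\<^bsub>G\<^esub> g"
  by (intro left_inv_eqI) (simp_all add: xi inv_G)

text \<open>Coordinate-free form of (2): \<open>\<xi> \<stileturn> x\<close> is the first coordinate
  of \<open>x\<close> under \<open>structure_map\<close>.\<close>

lemma left_translation_left_group:
  assumes x: "x \<in> carrier D"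
  shows "left_translation (conj_rack D) (\<xi> \<stileturn> x) = left_translation (conj_rack D) x"
proof -
  have "left_inv D \<xi> (\<xi> \<stileturn> x) = left_inv D \<xi> x"
    by (intro left_inv_eqI) (use x in \<open>simp_all add: xi dv_xi_absorb left_inv_eq\<close>)
  moreover have "(\<xi> \<stileturn> x) \<turnstile> y = x \<turnstile> y" if "y \<in> carrier D" for y
    using x that by (simp add: vd_left[symmetric])
  ultimately show ?thesis
    unfolding left_translation_def using x by (intro restrict_ext) (simp add: conj_op)
qed

text \<open>Multiplicativity holds because \<open>(g \<stileturn> h) \<turnstile> y = g \<turnstile>
  (h \<turnstile> y)\<close> and \<open>left_inv\<close> reverses products.\<close>

lemma group_hom_left_translation:
  "group_hom G (BijGroup (carrier D)) (left_translation (conj_rack D))"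
  unfolding group_hom_def group_hom_axioms_def hom_def
proof (intro conjI CollectI ballI funcsetI)
  let ?L = "left_translation (conj_rack D)"
  show "group G" by (rule group_left_group)
  show "group (BijGroup (carrier D))" by (rule group_BijGroup)
  show mem: "?L g \<in> carrier (BijGroup (carrier D))" if "g \<in> carrier G" for g
    using rack.translation_bij[OF rack_conj_rack, of g] that
    by (simp add: BijGroup_def Bij_def left_translation_def)
  fix g h assume gh: "g \<in> carrier G" "h \<in> carrier G"
  have "?L (g \<stileturn> h) = compose (carrier D) (?L g) (?L h)"
    unfolding left_translation_def compose_def conj_carrier
    using gh by (intro restrict_ext)
      (simp add: conj_op left_inv_mult vd_left[symmetric] vd_assoc vd_dv_assoc dv_assoc)
  then show "?L (g \<otimes>\<^bsub>G\<^esub> h) = ?L g \<otimes>\<^bsub>BijGroup (carrier D)\<^esub> ?L h"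
    using mem[OF gh(1)] mem[OF gh(2)] by (simp add: BijGroup_def)
qed

text \<open>
  Testing on \<open>E\<close> and on \<open>G\<close> inside \<open>D\<close> shows that a translation is trivial only if
  its element acts trivially and is central; conversely each \<open>y\<close> factors as \<open>\<alpha> \<stileturn> h\<close>
  with \<open>\<alpha> \<in> E\<close> and \<open>h \<in> G\<close>.
\<close>

lemma kernel_left_translation:
  "kernel G (BijGroup (carrier D)) (left_translation (conj_rack D))
     = center G \<inter> kernel G (BijGroup E) (halo_perm D \<xi>)"
proof -
  have trans: "left_translation (conj_rack D) g = \<one>\<^bsub>BijGroup (carrier D)\<^esub>
      \<longleftrightarrow> (\<forall>y\<in>carrier D. (g \<turnstile> y) \<stileturn> inv\<^bsub>G\<^esub> g = y)" if "g \<in> carrier G" for g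
    using that by (auto simp: left_translation_def BijGroup_def conj_op left_inv_G restrict_def
        fun_eq_iff)
  have perm: "halo_perm D \<xi> g = \<one>\<^bsub>BijGroup E\<^esub>
      \<longleftrightarrow> (\<forall>\<alpha>\<in>E. (g \<turnstile> \<alpha>) \<stileturn> inv\<^bsub>G\<^esub> g = \<alpha>)" for g
    by (auto simp: halo_perm_def BijGroup_def act_eq restrict_def fun_eq_iff E_def)
  have "(\<forall>y\<in>carrier D. (g \<turnstile> y) \<stileturn> inv\<^bsub>G\<^esub> g = y) \<longleftrightarrow>
      g \<in> center G \<and> (\<forall>\<alpha>\<in>E. (g \<turnstile> \<alpha>) \<stileturn> inv\<^bsub>G\<^esub> g = \<alpha>)" if g: "g \<in> carrier G" for g
  proof (intro iffI conjI ballI)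
    assume *: "\<forall>y\<in>carrier D. (g \<turnstile> y) \<stileturn> inv\<^bsub>G\<^esub> g = y"
    show "(g \<turnstile> \<alpha>) \<stileturn> inv\<^bsub>G\<^esub> g = \<alpha>" if "\<alpha> \<in> E" for \<alpha> using * that by simp
    have "g \<stileturn> h = h \<stileturn> g" if h: "h \<in> carrier G" for h
    proof -
      \<comment> \<open>A factor \<open>\<xi>\<close> on the left brings the fixed-point equation
        for \<open>h\<close> into \<open>G\<close>: behind \<open>\<xi> \<stileturn>\<close> the
        product \<open>g \<turnstile> h\<close> may be read as
        \<open>g \<stileturn> h\<close>.\<close>
      have "h \<stileturn> g = \<xi> \<stileturn> (((g \<turnstile> h) \<stileturn> inv\<^bsub>G\<^esub> g) \<stileturn> g)"
        using * g h by (simp add: dv_assoc[symmetric] xi_G)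
      also have "\<dots> = \<xi> \<stileturn> (g \<turnstile> h)"
        using g h xi by (simp add: dv_assoc inv_G haloD)
      also have "\<dots> = g \<stileturn> h"
        using g h by (simp add: dv_right[symmetric] dv_assoc[symmetric] xi_G)
      finally show ?thesis by simp
    qed
    then show "g \<in> center G" using g by (simp add: center_def)
  next
    assume *: "g \<in> center G \<and> (\<forall>\<alpha>\<in>E. (g \<turnstile> \<alpha>) \<stileturn> inv\<^bsub>G\<^esub> g = \<alpha>)"
    fix y assume y: "y \<in> carrier D"
    let ?a = "y \<stileturn> left_inv D \<xi> y" and ?h = "\<xi> \<stileturn> y"
    have a: "?a \<in> E" and h: "?h \<in> carrier G" using y by (simp_all add: halo_coordinate)
    have yeq: "y = ?a \<stileturn> ?h" using y by (simp add: dv_xi_absorb dv_assoc left_inv_eq haloD xi)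
    have comm: "?h \<stileturn> inv\<^bsub>G\<^esub> g = inv\<^bsub>G\<^esub> g \<stileturn> ?h"
    proof -
      have "g \<otimes>\<^bsub>G\<^esub> ?h = ?h \<otimes>\<^bsub>G\<^esub> g" using * h by (simp add: center_def)
      then have "?h \<otimes>\<^bsub>G\<^esub> inv\<^bsub>G\<^esub> g = inv\<^bsub>G\<^esub> g \<otimes>\<^bsub>G\<^esub> ?h"
        using g h by (metis G.inv_closed G.inv_solve_left G.inv_solve_right G.m_assoc G.m_closed)
      then show ?thesis by simp
    qed
    \<comment> \<open>Centrality moves the inverse of \<open>g\<close> past \<open>?h\<close>, next
      to \<open>?a\<close>, where the trivial action applies.\<close>
    have "(g \<turnstile> (?a \<stileturn> ?h)) \<stileturn> inv\<^bsub>G\<^esub> g = (g \<turnstile> ?a) \<stileturn> (?h \<stileturn> inv\<^bsub>G\<^esub> g)"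
      using g a h by (simp add: vd_dv_assoc dv_assoc)
    also have "\<dots> = ((g \<turnstile> ?a) \<stileturn> inv\<^bsub>G\<^esub> g) \<stileturn> ?h"
      unfolding comm using g E_D[OF a] G_sub[OF h] by (simp only: dv_assoc inv_D G_sub vd_closed)
    also have "\<dots> = ?a \<stileturn> ?h" using * a by simp
    finally show "(g \<turnstile> y) \<stileturn> inv\<^bsub>G\<^esub> g = y" using yeq by simp
  qed
  then show ?thesis
    by (auto simp: kernel_def trans perm)
qed

theorem normal_center_kernel:
  "center G \<inter> kernel G (BijGroup E) (halo_perm D \<xi>) \<lhd> G"
  using group_hom.normal_kernel[OF group_hom_left_translation]
  by (simp add: kernel_left_translation)

theorem Inn_conj_rack_iso:
  "Inn (conj_rack D) \<cong> G Mod (center G \<inter> kernel G (BijGroup E) (halo_perm D \<xi>))"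
proof -
  let ?L = "left_translation (conj_rack D)" and ?B = "BijGroup (carrier D)"
  interpret L: group_hom G ?B ?L by (rule group_hom_left_translation)
  have img: "?L ` carrier D = ?L ` carrier G"
    unfolding G_carrier image_image by (intro image_cong) (simp_all add: left_translation_left_group)
  have inn: "Inn (conj_rack D) = subgroup_generated ?B (?L ` carrier G)"
    by (simp add: Inn_def img)
  \<comment> \<open>The image of a homomorphism is already a subgroup, so generating adds no
    elements.\<close>
  have carr: "carrier (Inn (conj_rack D)) = ?L ` carrier G"
    unfolding inn by (rule subgroup.carrier_subgroup_generated_subgroup[OF L.img_is_subgroup])
  \<comment> \<open>Shrinking the codomain to \<open>Inn\<close> makes the homomorphism surjective
    without changing its kernel.\<close>
  have "group_hom G (Inn (conj_rack D)) ?L"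
    unfolding group_hom_def group_hom_axioms_def hom_def
    by (auto simp: group_left_group carr simp del: G_sel)
      (auto simp: inn L.H.group_subgroup_generated simp del: G_sel)
  then interpret I: group_hom G "Inn (conj_rack D)" ?L .
  have "kernel G (Inn (conj_rack D)) ?L = kernel G ?B ?L"
    by (simp add: kernel_def inn)
  then have "G Mod (center G \<inter> kernel G (BijGroup E) (halo_perm D \<xi>)) \<cong> Inn (conj_rack D)"
    using I.FactGroup_iso[OF carr[symmetric]] by (simp add: kernel_left_translation)
  then show ?thesis
    by (rule group.iso_sym[OF normal.factorgroup_is_group[OF normal_center_kernel]])
qed

end

section \<open>Coordinates\<close>

text \<open>The action is a plain function, unlike the extensional permutations of
  \<open>group_action\<close>, to match \<open>action_digroup\<close>. Nonemptiness of
  \<open>E\<close> supplies the bar-units.\<close>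

locale set_action = group G for G :: "('a, 'm) monoid_scheme" (structure) +
  fixes E :: "'b set" and act :: "'a \<Rightarrow> 'b \<Rightarrow> 'b"
  assumes E_nonempty: "E \<noteq> {}"
    and act_closed [simp]: "\<lbrakk>g \<in> carrier G; \<alpha> \<in> E\<rbrakk> \<Longrightarrow> act g \<alpha> \<in> E"
    and act_one [simp]: "\<alpha> \<in> E \<Longrightarrow> act \<one> \<alpha> = \<alpha>"
    and act_mult: "\<lbrakk>g \<in> carrier G; h \<in> carrier G; \<alpha> \<in> E\<rbrakk> \<Longrightarrow> act (g \<otimes> h) \<alpha> = act g (act h \<alpha>)"
begin

lemma action_digroup_sel [simp]:
  "carrier (action_digroup G E act) = carrier G \<times> E"
  "(g, \<alpha>) \<turnstile>\<^bsub>action_digroup G E act\<^esub> (h, \<beta>) = (g \<otimes> h, act g \<beta>)"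
  "(g, \<alpha>) \<stileturn>\<^bsub>action_digroup G E act\<^esub> (h, \<beta>) = (g \<otimes> h, \<alpha>)"
  by (simp_all add: action_digroup_def)

text \<open>Testing a bar-unit on the right of an element with first coordinate
  \<open>\<one>\<close> forces its own first coordinate to be \<open>\<one>\<close>.\<close>

lemma halo_action_digroup: "halo (action_digroup G E act) = {\<one>} \<times> E"
proof -
  have "g = \<one>" if "(g, \<alpha>) \<in> halo (action_digroup G E act)" for g \<alpha>
  proof -
    have "(\<one>, \<alpha>) \<stileturn>\<^bsub>action_digroup G E act\<^esub> (g, \<alpha>) = (\<one>, \<alpha>)" "g \<in> carrier G"
      using that by (auto simp: halo_def)
    then show ?thesis by simp
  qed
  then show ?thesis by (auto simp: halo_def)
qed

theorem generalized_digroup_action_digroup: "generalized_digroup (action_digroup G E act)"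
proof
  let ?P = "action_digroup G E act"
  show "halo ?P \<noteq> {}" using E_nonempty by (auto simp: halo_action_digroup)
  fix e x assume "e \<in> halo ?P" "x \<in> carrier ?P"
  then obtain \<epsilon> g \<alpha> where [simp]: "e = (\<one>, \<epsilon>)" "x = (g, \<alpha>)" "\<epsilon> \<in> E" "g \<in> carrier G" "\<alpha> \<in> E"
    by (auto simp: halo_action_digroup)
  \<comment> \<open>In \<open>x \<turnstile> y\<close> the element \<open>g\<close> acts on the
    second coordinate of \<open>y\<close>, so \<open>\<epsilon>\<close> is first moved back by
    \<open>inv g\<close>. In \<open>y \<stileturn> x\<close> the left factor keeps its second
    coordinate, so \<open>\<epsilon>\<close> itself serves.\<close>
  show "\<exists>y\<in>carrier ?P. x \<turnstile>\<^bsub>?P\<^esub> y = e"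
    by (rule bexI[of _ "(inv g, act (inv g) \<epsilon>)"]) (simp_all add: act_mult[symmetric])
  show "\<exists>y\<in>carrier ?P. y \<stileturn>\<^bsub>?P\<^esub> x = e"
    by (rule bexI[of _ "(inv g, \<epsilon>)"]) simp_all
qed (auto simp: act_mult m_assoc)

lemma conj_action_carrier: "carrier (conj_rack (action_digroup G E act)) = carrier G \<times> E"
  by (simp add: conj_rack_def)

lemma conj_action_op:
  assumes "g \<in> carrier G" "\<alpha> \<in> E" "h \<in> carrier G" "\<beta> \<in> E"
  shows "(g, \<alpha>) \<triangleright>\<^bsub>conj_rack (action_digroup G E act)\<^esub> (h, \<beta>) = (g \<otimes> h \<otimes> inv g, act g \<beta>)"
proof -
  have "one_sided_inverse (action_digroup G E act) (g, \<alpha>) (inv g, \<alpha>)"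
    using assms by (simp add: one_sided_inverse_def halo_action_digroup)
  then show ?thesis
    using assms by (simp add: generalized_digroup.conj_rack_op_eq[OF generalized_digroup_action_digroup])
qed

end

section \<open>Conjugation racks of groups and transport along digroup isomorphisms\<close>

lemma (in group) rack_conj_group_rack: "rack (conj_group_rack G)"
proof
  have cancel: "inv g \<otimes> (g \<otimes> h) = h" "g \<otimes> (inv g \<otimes> h) = h"
    if "g \<in> carrier G" "h \<in> carrier G" for g h
    using that by (simp_all add: m_assoc[symmetric])
  show "carrier (conj_group_rack G) \<noteq> {}"
    using one_closed by (auto simp: conj_group_rack_def simp del: one_closed)
  fix g assume "g \<in> carrier (conj_group_rack G)"
  then have g: "g \<in> carrier G" by (simp add: conj_group_rack_def)
  have "bij_betw (\<lambda>h. g \<otimes> h \<otimes> inv g) (carrier G) (carrier G)"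
    by (rule bij_betw_byWitness[of _ "\<lambda>h. inv g \<otimes> h \<otimes> g"])
      (use g in \<open>auto simp: m_assoc cancel\<close>)
  then show "bij_betw (\<lambda>h. g \<triangleright>\<^bsub>conj_group_rack G\<^esub> h)
      (carrier (conj_group_rack G)) (carrier (conj_group_rack G))"
    by (simp add: conj_group_rack_def)
  fix h k assume "h \<in> carrier (conj_group_rack G)" "k \<in> carrier (conj_group_rack G)"
  with g show "g \<triangleright>\<^bsub>conj_group_rack G\<^esub> (h \<triangleright>\<^bsub>conj_group_rack G\<^esub> k) =
      (g \<triangleright>\<^bsub>conj_group_rack G\<^esub> h) \<triangleright>\<^bsub>conj_group_rack G\<^esub> (g \<triangleright>\<^bsub>conj_group_rack G\<^esub> k)"
    by (simp add: conj_group_rack_def inv_mult_group m_assoc cancel)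
qed

text \<open>The inverses chosen by \<open>SOME\<close> need not correspond under \<open>f\<close>.
  By surjectivity \<open>f\<close> preserves bar-units, hence carries a left inverse to a one-sided
  inverse, and the conjugation operation does not depend on the choice.\<close>

lemma (in generalized_digroup) digroup_iso_imp_rack_iso:
  assumes P: "generalized_digroup P" and f: "f \<in> digroup_iso D P"
  shows "f \<in> rack_iso (conj_rack D) (conj_rack P)"
proof -
  interpret P: generalized_digroup P by (rule P)
  have bij: "bij_betw f (carrier D) (carrier P)"
    and vd: "\<And>x y. \<lbrakk>x \<in> carrier D; y \<in> carrier D\<rbrakk> \<Longrightarrow> f (x \<turnstile> y) = f x \<turnstile>\<^bsub>P\<^esub> f y"
    and dv: "\<And>x y. \<lbrakk>x \<in> carrier D; y \<in> carrier D\<rbrakk> \<Longrightarrow> f (x \<stileturn> y) = f x \<stileturn>\<^bsub>P\<^esub> f y"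
    using f by (auto simp: digroup_iso_def)
  have mem: "f x \<in> carrier P" if "x \<in> carrier D" for x
    using bij that by (auto simp: bij_betw_def)
  have halo: "f e \<in> halo P" if e: "e \<in> halo D" for e
  proof -
    have "y \<stileturn>\<^bsub>P\<^esub> f e = y \<and> f e \<turnstile>\<^bsub>P\<^esub> y = y" if "y \<in> carrier P" for y
    proof -
      obtain x where "x \<in> carrier D" "y = f x" using bij \<open>y \<in> carrier P\<close> by (auto simp: bij_betw_def)
      then show ?thesis using e by (metis haloD dv vd)
    qed
    then show ?thesis using mem e by (simp add: halo_def)
  qed
  have "f (x \<triangleright>\<^bsub>conj_rack D\<^esub> y) = f x \<triangleright>\<^bsub>conj_rack P\<^esub> f y"
    if x: "x \<in> carrier D" and y: "y \<in> carrier D" for x y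
  proof -
    obtain \<xi> where "\<xi> \<in> halo D" using halo_nonempty by blast
    then obtain l where l: "l \<in> carrier D" "l \<stileturn> x \<in> halo D"
      using left_inverse_ex[OF _ x] by metis
    have 1: "one_sided_inverse D x l" using l by (simp add: one_sided_inverse_def)
    have 2: "one_sided_inverse P (f x) (f l)"
      using l x halo[OF l(2)] by (simp add: one_sided_inverse_def mem dv)
    show ?thesis
      using x y l(1) by (simp add: conj_rack_op_eq[OF _ _ 1] P.conj_rack_op_eq[OF _ _ 2] mem vd dv)
  qed
  then show ?thesis
    using bij mem by (auto simp: rack_iso_def rack_hom_def conj_rack_def)
qed

section \<open>The coordinate form of the conjugation rack and its fibers over the group\<close>

theorem theorem4p1:
  fixes D :: "('a, 'm) digroup_scheme" and \<xi> :: 'a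
  assumes "generalized_digroup D"
    and "finite (carrier D)"
    and "\<xi> \<in> halo D"
  defines "G \<equiv> left_group D \<xi>"
    and "E \<equiv> halo D"
    and "act \<equiv> halo_act D \<xi>"
    and "\<rho> \<equiv> halo_perm D \<xi>"
    and "\<phi> \<equiv> structure_map D \<xi>"
  defines "P \<equiv> action_digroup G E act"
  shows
    "\<comment> \<open>\<open>Conj(D)\<close> in the coordinates of the structure isomorphism\<close>
     rack (conj_rack D) \<and> rack (conj_rack P) \<and>
     \<phi> \<in> rack_iso (conj_rack D) (conj_rack P) \<and>
     carrier (conj_rack P) = carrier G \<times> E \<and>
     (\<forall>g \<in> carrier G. \<forall>\<alpha> \<in> E. \<forall>h \<in> carrier G. \<forall>\<beta> \<in> E.
        (g, \<alpha>) \<triangleright>\<^bsub>conj_rack P\<^esub> (h, \<beta>) = (g \<otimes>\<^bsub>G\<^esub> h \<otimes>\<^bsub>G\<^esub> inv\<^bsub>G\<^esub> g, act g \<beta>)) \<and>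
     \<comment> \<open>(1)\<close>
     fst \<in> rack_hom (conj_rack P) (conj_group_rack G) \<and>
     fst ` carrier (conj_rack P) = carrier (conj_group_rack G) \<and>
     \<comment> \<open>(2)\<close>
     (\<forall>g \<in> carrier G. \<forall>\<alpha> \<in> E.
        left_translation (conj_rack P) (g, \<alpha>) =
          restrict (map_prod (\<lambda>h. g \<otimes>\<^bsub>G\<^esub> h \<otimes>\<^bsub>G\<^esub> inv\<^bsub>G\<^esub> g) (\<rho> g)) (carrier G \<times> E)) \<and>
     (\<forall>g \<in> carrier G. \<forall>\<alpha> \<in> E. \<forall>\<alpha>' \<in> E.
        left_translation (conj_rack P) (g, \<alpha>) = left_translation (conj_rack P) (g, \<alpha>')) \<and>
     \<comment> \<open>(3)\<close>
     center G \<inter> kernel G (BijGroup E) \<rho> \<lhd> G \<and>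
     Inn (conj_rack D) \<cong> G Mod (center G \<inter> kernel G (BijGroup E) \<rho>) \<and>
     \<comment> \<open>\<open>Conj(D)\<close> is a rack over \<open>Conj(G)\<close> with fiber \<open>E\<close>\<close>
     rack_over (conj_rack D) (conj_group_rack G) (fst \<circ> \<phi>) \<and>
     (\<forall>g \<in> carrier G. bij_betw (snd \<circ> \<phi>) {x \<in> carrier D. (fst \<circ> \<phi>) x = g} E)"
proof -
  interpret pointed_generalized_digroup D \<xi> G E
    using assms(1,3) by (intro pointed_generalized_digroup.intro pointed_generalized_digroup_axioms.intro)
      (simp_all add: G_def E_def)
  interpret A: set_action G E act
    unfolding act_def
    by (intro set_action.intro set_action_axioms.intro group_left_group)
      (use xi_E in \<open>auto simp: act_closed act_one act_mult simp del: xi_E\<close>)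
  have gP: "generalized_digroup P"
    unfolding P_def by (rule A.generalized_digroup_action_digroup)
  have di: "\<phi> \<in> digroup_iso D P"
    unfolding \<phi>_def P_def act_def by (rule structure_map_iso)
  have iso: "\<phi> \<in> rack_iso (conj_rack D) (conj_rack P)"
    by (rule digroup_iso_imp_rack_iso[OF gP di])
  obtain e where "e \<in> halo P" using generalized_digroup.halo_nonempty[OF gP] by blast
  \<comment> \<open>The coordinate model is itself a generalized digroup, so the general rack
    theorem applies to it with any of its bar-units.\<close>
  then have rackP: "rack (conj_rack P)"
    using gP by (intro pointed_generalized_digroup.rack_conj_rack[of P e]
        pointed_generalized_digroup.intro pointed_generalized_digroup_axioms.intro)
  have carP: "carrier (conj_rack P) = carrier G \<times> E"
    unfolding P_def by (rule A.conj_action_carrier)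
  have op: "(g, \<alpha>) \<triangleright>\<^bsub>conj_rack P\<^esub> (h, \<beta>) = (g \<otimes>\<^bsub>G\<^esub> h \<otimes>\<^bsub>G\<^esub> inv\<^bsub>G\<^esub> g, act g \<beta>)"
    if "g \<in> carrier G" "\<alpha> \<in> E" "h \<in> carrier G" "\<beta> \<in> E" for g \<alpha> h \<beta>
    unfolding P_def using that by (rule A.conj_action_op)
  have fst_hom: "fst \<in> rack_hom (conj_rack P) (conj_group_rack G)"
    by (auto simp: rack_hom_def carP op conj_group_rack_def simp del: G_sel)
  have fst_img: "fst ` carrier (conj_rack P) = carrier (conj_group_rack G)"
    using A.E_nonempty by (simp add: carP conj_group_rack_def)
  have trans: "left_translation (conj_rack P) (g, \<alpha>) =
      restrict (map_prod (\<lambda>h. g \<otimes>\<^bsub>G\<^esub> h \<otimes>\<^bsub>G\<^esub> inv\<^bsub>G\<^esub> g) (\<rho> g)) (carrier G \<times> E)"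
    if "g \<in> carrier G" "\<alpha> \<in> E" for g \<alpha>
    unfolding left_translation_def carP
    using that by (intro restrict_ext)
      (auto simp: op \<rho>_def halo_perm_def act_def E_def[symmetric] simp del: G_sel)
  have bij: "bij_betw \<phi> (carrier D) (carrier G \<times> E)"
    and hom: "\<phi> \<in> rack_hom (conj_rack D) (conj_rack P)"
    using iso by (auto simp: rack_iso_def carP)
  have img: "\<phi> ` carrier (conj_rack D) = carrier (conj_rack P)"
    using bij by (simp add: bij_betw_def carP)
  have "fst \<circ> \<phi> \<in> rack_hom (conj_rack D) (conj_group_rack G)"
    using hom fst_hom by (fastforce simp: rack_hom_def)
  moreover have "(fst \<circ> \<phi>) ` carrier (conj_rack D) = carrier (conj_group_rack G)"
    by (simp only: image_comp[symmetric] img fst_img)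
  ultimately have over: "rack_over (conj_rack D) (conj_group_rack G) (fst \<circ> \<phi>)"
    by (simp only: rack_over_def rack_conj_rack A.rack_conj_group_rack simp_thms)
  have fiber: "bij_betw (snd \<circ> \<phi>) {x \<in> carrier D. (fst \<circ> \<phi>) x = g} E"
    if g: "g \<in> carrier G" for g
  proof (rule bij_betw_trans)
    \<comment> \<open>The fiber is carried by \<open>\<phi>\<close> onto
      \<open>{g} \<times> E\<close>, where \<open>snd\<close> is injective.\<close>
    have "\<phi> ` {x \<in> carrier D. (fst \<circ> \<phi>) x = g} = {p \<in> \<phi> ` carrier D. fst p = g}"
      by auto
    also have "\<dots> = {g} \<times> E"
      using bij g by (auto simp: bij_betw_def)
    finally show "bij_betw \<phi> {x \<in> carrier D. (fst \<circ> \<phi>) x = g} ({g} \<times> E)"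
      using bij by (auto simp: bij_betw_def intro: inj_on_subset)
    show "bij_betw snd ({g} \<times> E) E"
      by (auto simp: bij_betw_def inj_on_def)
  qed
  show ?thesis
    using rack_conj_rack rackP iso carP op fst_hom fst_img trans
      normal_center_kernel Inn_conj_rack_iso over fiber
    by (simp add: \<rho>_def del: G_sel comp_apply)
qed

end
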